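(* (ZFC) If there exists a $\boldsymbol{\Sigma}^1_2$ maximal independent family, then there exists a $\boldsymbol{\Pi}^1_1$ maximal independent family.
   Context: $[\omega]^\omega$ is the set of infinite subsets of $\omega$. A family $\mathcal{I}\subseteq[\omega]^\omega$ is independent if for all $a_1,\dots,a_n\in\mathcal{I}$ and all $b_1,\dots,b_\ell\in\mathcal{I}$ such that every $a_i$ is different from every $b_j$, the set $a_1\cap\dots\cap a_n\cap(\omega\setminus b_1)\cap\dots\cap(\omega\setminus b_\ell)$ is infinite. A maximal independent family (m.i.f.) is an independent family that is maximal under inclusion among independent families. Subsets of $\omega$ are identified with elements of $2^\omega$ via characteristic functions, so families $\mathcal{I}\subseteq[\omega]^\omega$ are sets of reals and can be classified in the (boldface) projective hierarchy. *)

theory Defs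
  imports "HOL-Analysis.Analysis"
begin

text \<open>
  Intersections over empty index sets are read as \<open>UNIV\<close>: \<open>A\<close> or \<open>B\<close> may be empty.
  Requiring both to be nonempty would make \<open>{UNIV}\<close> a maximal independent family.
\<close>

definition independent_family :: "nat set set \<Rightarrow> bool" where
  "independent_family \<I> \<longleftrightarrow>
     (\<forall>a\<in>\<I>. infinite a) \<and>
     (\<forall>A B. finite A \<longrightarrow> finite B \<longrightarrow> A \<subseteq> \<I> \<longrightarrow> B \<subseteq> \<I> \<longrightarrow> A \<inter> B = {} \<longrightarrow>
        infinite ((\<Inter>a\<in>A. a) \<inter> (\<Inter>b\<in>B. UNIV - b)))"

definition maximal_independent_family :: "nat set set \<Rightarrow> bool" where
  "maximal_independent_family \<I> \<longleftrightarrow>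
     independent_family \<I> \<and> (\<forall>\<J>. independent_family \<J> \<longrightarrow> \<I> \<subseteq> \<J> \<longrightarrow> \<J> = \<I>)"

text \<open>
  The boldface classes are meant for Polish spaces \<open>'a\<close>. Baire space is \<^typ>\<open>nat \<Rightarrow> nat\<close> and
  Cantor space is \<^typ>\<open>nat \<Rightarrow> bool\<close>, both with the product topology over discrete factors.
\<close>

definition boldface_Sigma11 :: "'a::topological_space set \<Rightarrow> bool" where
  "boldface_Sigma11 X \<longleftrightarrow> (\<exists>C :: ('a \<times> (nat \<Rightarrow> nat)) set. closed C \<and> X = fst ` C)"

definition boldface_Pi11 :: "'a::topological_space set \<Rightarrow> bool" where
  "boldface_Pi11 X \<longleftrightarrow> boldface_Sigma11 (- X)"

definition boldface_Sigma12 :: "'a::topological_space set \<Rightarrow> bool" where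
  "boldface_Sigma12 X \<longleftrightarrow> (\<exists>P :: ('a \<times> (nat \<Rightarrow> nat)) set. boldface_Pi11 P \<and> X = fst ` P)"

definition char_fun :: "nat set \<Rightarrow> (nat \<Rightarrow> bool)" where
  "char_fun a = (\<lambda>n. n \<in> a)"

end

theory Submission
  imports Defs "HOL-Library.Nat_Bijection"
begin

text \<open>
  Uniformizing a coanalytic set whose projection is the given family \<open>\<I>\<close> yields a coanalytic set
  \<open>H\<close> of reals that a continuous map sends bijectively onto \<open>\<I>\<close>. Replace the set \<open>x\<close> coming from
  \<open>h \<in> H\<close> by the disjoint sum of \<open>x\<close> and the set of initial segments of \<open>h\<close>. The new family is
  coanalytic, since \<open>h\<close> can be read off from its image, and it is independent because its traces
  on the first summand form \<open>\<I>\<close>. Distinct branches share only finitely many initial segments, so after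
  adding two further members to a Boolean combination only the first summand matters. This gives maximality.

  Uniformization picks from each section the well-founded tree that is lexicographically least with
  respect to the ranks of its nodes. Ranks are compared by simulations between trees, which avoids ordinals
  and makes the comparison visibly analytic.
\<close>

subsection \<open>Closure properties of analytic sets\<close>

lemma Sigma11I:
  assumes "closed {(a, z::nat \<Rightarrow> nat). Q a z}"
  shows "boldface_Sigma11 {a::'a::topological_space. \<exists>z. Q a z}"
  unfolding boldface_Sigma11_def using assms by (intro exI[of _ "{(a, z). Q a z}"]) force

lemma Sigma11D:
  fixes P :: "'a::topological_space \<Rightarrow> bool"
  assumes "boldface_Sigma11 {a. P a}"
  shows "\<exists>Q. closed {(a, z::nat \<Rightarrow> nat). Q a z} \<and> (\<forall>a. P a \<longleftrightarrow> (\<exists>z. Q a z))"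
proof -
  obtain C :: "('a \<times> (nat \<Rightarrow> nat)) set" where C: "closed C" "{a. P a} = fst ` C"
    using assms unfolding boldface_Sigma11_def by blast
  have "P a \<longleftrightarrow> (\<exists>z. (a, z) \<in> C)" for a
    using C(2) by (metis (no_types, lifting) Domain.simps Domain_fst mem_Collect_eq)
  moreover have "closed {(a, z). (a, z) \<in> C}"
    using C(1) by simp
  ultimately show ?thesis
    by blast
qed

lemma closed_Collect_comp2:
  assumes "closed {(b, z). Q b z}" "continuous_on UNIV f" "continuous_on UNIV g"
  shows "closed {p. Q (f p) (g p)}"
proof -
  have "closed ((\<lambda>p. (f p, g p)) -` {(b, z). Q b z})"
    using assms by (intro closed_vimage continuous_intros) auto
  then show ?thesis
    by (simp add: vimage_def)
qed

lemma continuous_on_reindex: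
  fixes g :: "'a::topological_space \<Rightarrow> 'b \<Rightarrow> 'c::topological_space"
  assumes "continuous_on S g"
  shows "continuous_on S (\<lambda>p k. g p (h k))"
  by (rule continuous_on_coordinatewise_then_product)
     (rule continuous_on_product_then_coordinatewise[OF assms])

lemmas continuous_on_snd_reindex = continuous_on_reindex[OF continuous_on_snd[OF continuous_on_id]]

lemma Sigma11_closed: "closed {a::'a::topological_space. P a} \<Longrightarrow> boldface_Sigma11 {a. P a}"
  using Sigma11I[of "\<lambda>a z. P a"] closed_vimage_fst[of "{a. P a}"]
  by (simp add: vimage_def case_prod_unfold)

lemma Sigma11_comp:
  fixes f :: "'a::topological_space \<Rightarrow> 'b::topological_space"
  assumes "boldface_Sigma11 {b. P b}" "continuous_on UNIV f"
  shows "boldface_Sigma11 {a. P (f a)}"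
proof -
  obtain Q where Q: "closed {(b, z::nat \<Rightarrow> nat). Q b z}" "\<And>b. P b \<longleftrightarrow> (\<exists>z. Q b z)"
    using Sigma11D[OF assms(1)] by blast
  have "continuous_on UNIV (\<lambda>p::'a \<times> (nat \<Rightarrow> nat). f (fst p))"
    by (rule continuous_on_compose2[OF assms(2) continuous_on_fst[OF continuous_on_id]]) simp
  from closed_Collect_comp2[OF Q(1) this, of snd]
  have "closed {(a, z). Q (f a) z}"
    by (simp add: case_prod_unfold continuous_on_snd)
  from Sigma11I[OF this] show ?thesis
    by (simp add: Q(2))
qed

text \<open>Two witnesses are interleaved into one real: \<open>y\<close> on the even coordinates,
  the witness for \<open>P a y\<close> on the odd ones.\<close>

lemma Sigma11_ex_real:
  fixes P :: "'a::topological_space \<Rightarrow> (nat \<Rightarrow> nat) \<Rightarrow> bool"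
  assumes "boldface_Sigma11 {p. P (fst p) (snd p)}"
  shows "boldface_Sigma11 {a. \<exists>y. P a y}"
proof -
  obtain Q where Q: "closed {(b, z::nat \<Rightarrow> nat). Q b z}"
      "\<And>b. P (fst b) (snd b) \<longleftrightarrow> (\<exists>z. Q b z)"
    using Sigma11D[OF assms(1)] by blast
  have cl: "closed {p. Q (fst p, \<lambda>k. snd p (2 * k)) (\<lambda>k. snd p (2 * k + 1))}"
    by (rule closed_Collect_comp2[OF Q(1)])
       (intro continuous_on_Pair continuous_on_snd_reindex continuous_on_fst continuous_on_id)+
  have *: "(\<exists>y. P a y) \<longleftrightarrow> (\<exists>z. Q (a, \<lambda>k. z (2 * k)) (\<lambda>k. z (2 * k + 1)))" for a
  proof
    assume "\<exists>y. P a y"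
    then obtain y z where "Q (a, y) z"
      using Q(2)[of "(a, y)" for y] by auto
    then show "\<exists>z. Q (a, \<lambda>k. z (2 * k)) (\<lambda>k. z (2 * k + 1))"
      by (intro exI[of _ "\<lambda>k. if even k then y (k div 2) else z (k div 2)"]) simp
  next
    assume "\<exists>z. Q (a, \<lambda>k. z (2 * k)) (\<lambda>k. z (2 * k + 1))"
    then obtain z where "Q (a, \<lambda>k. z (2 * k)) (\<lambda>k. z (2 * k + 1))" ..
    then have "P a (\<lambda>k. z (2 * k))"
      using Q(2)[of "(a, \<lambda>k. z (2 * k))"] by auto
    then show "\<exists>y. P a y" by (rule exI[of "P a"])
  qed
  show ?thesis
    unfolding * by (rule Sigma11I) (use cl in \<open>simp add: case_prod_unfold\<close>)
qed

text \<open>One real carries a chosen witness for every \<open>n\<close> in its rows under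
  \<open>prod_encode\<close>, and an intersection of closed conditions is closed.\<close>

lemma Sigma11_all_nat:
  fixes P :: "nat \<Rightarrow> 'a::topological_space \<Rightarrow> bool"
  assumes "\<And>n. boldface_Sigma11 {a. P n a}"
  shows "boldface_Sigma11 {a. \<forall>n. P n a}"
proof -
  have "\<forall>n. \<exists>Q. closed {(a, z::nat \<Rightarrow> nat). Q a z} \<and> (\<forall>a. P n a \<longleftrightarrow> (\<exists>z. Q a z))"
    using Sigma11D[OF assms] by (rule allI)
  from choice[OF this] obtain Q where
    "\<forall>n. closed {(a, z::nat \<Rightarrow> nat). Q n a z} \<and> (\<forall>a. P n a \<longleftrightarrow> (\<exists>z. Q n a z))" ..
  then have Q: "\<And>n. closed {(a, z::nat \<Rightarrow> nat). Q n a z}" "\<And>n a. P n a \<longleftrightarrow> (\<exists>z. Q n a z)"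
    by simp_all
  have cl: "closed {p. Q n (fst p) (\<lambda>k. snd p (prod_encode (n, k)))}" for n
    by (rule closed_Collect_comp2[OF Q(1)[of n]])
       (intro continuous_on_snd_reindex continuous_on_fst continuous_on_id)+
  have *: "(\<forall>n. P n a) \<longleftrightarrow> (\<exists>z. \<forall>n. Q n a (\<lambda>k. z (prod_encode (n, k))))" for a
  proof
    assume "\<forall>n. P n a"
    then have "\<forall>n. \<exists>z. Q n a z"
      by (simp add: Q(2))
    from choice[OF this] obtain z where "\<forall>n. Q n a (z n)" ..
    then show "\<exists>z. \<forall>n. Q n a (\<lambda>k. z (prod_encode (n, k)))"
      by (intro exI[of _ "\<lambda>m. case prod_decode m of (n, k) \<Rightarrow> z n k"]) simp
  next
    assume "\<exists>z. \<forall>n. Q n a (\<lambda>k. z (prod_encode (n, k)))"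
    then show "\<forall>n. P n a"
      unfolding Q(2) by (elim exE, intro allI exI) (rule spec)
  qed
  show ?thesis
    unfolding * by (rule Sigma11I) (simp only: case_prod_unfold closed_Collect_all[OF cl])
qed

lemma clopen_Collect_eq:
  fixes f :: "'a::topological_space \<Rightarrow> 'b::discrete_topology"
  assumes "continuous_on UNIV f"
  shows "open {a. f a = k}" "closed {a. f a = k}"
  using open_vimage[OF open_discrete assms, of "{k}"]
    open_vimage[OF open_discrete assms, of "- {k}"]
  by (simp_all add: vimage_def closed_def Collect_neg_eq)

lemma Sigma11_ex_nat:
  fixes P :: "nat \<Rightarrow> 'a::topological_space \<Rightarrow> bool"
  assumes "\<And>n. boldface_Sigma11 {a. P n a}"
  shows "boldface_Sigma11 {a. \<exists>n. P n a}"
proof -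
  have "\<forall>n. \<exists>Q. closed {(a, z::nat \<Rightarrow> nat). Q a z} \<and> (\<forall>a. P n a \<longleftrightarrow> (\<exists>z. Q a z))"
    using Sigma11D[OF assms] by (rule allI)
  from choice[OF this] obtain Q where
    "\<forall>n. closed {(a, z::nat \<Rightarrow> nat). Q n a z} \<and> (\<forall>a. P n a \<longleftrightarrow> (\<exists>z. Q n a z))" ..
  then have Q: "\<And>n. closed {(a, z::nat \<Rightarrow> nat). Q n a z}" "\<And>n a. P n a \<longleftrightarrow> (\<exists>z. Q n a z)"
    by simp_all
  \<comment> \<open>Coordinate \<open>0\<close> of the witness names the index. As
    \<open>snd p 0 = n\<close> is clopen, the union over \<open>n\<close> becomes an intersection of
    closed implications.\<close>
  have cl: "closed {p. snd p 0 = n \<longrightarrow> Q n (fst p) (\<lambda>k. snd p (Suc k))}" for n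
  proof (rule closed_Collect_imp)
    show "open {p::'a \<times> (nat \<Rightarrow> nat). snd p 0 = n}"
      by (rule clopen_Collect_eq(1), rule continuous_on_product_then_coordinatewise)
         (rule continuous_on_snd[OF continuous_on_id])
    show "closed {p. Q n (fst p) (\<lambda>k. snd p (Suc k))}"
      by (rule closed_Collect_comp2[OF Q(1)[of n]])
         (intro continuous_on_snd_reindex continuous_on_fst continuous_on_id)+
  qed
  have *: "(\<exists>n. P n a) \<longleftrightarrow> (\<exists>z. \<forall>n. z 0 = n \<longrightarrow> Q n a (\<lambda>k. z (Suc k)))" for a
  proof
    assume "\<exists>n. P n a"
    then obtain n z where "Q n a z"
      using Q(2) by metis
    then show "\<exists>z. \<forall>n. z 0 = n \<longrightarrow> Q n a (\<lambda>k. z (Suc k))"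
      by (intro exI[of _ "\<lambda>m. case m of 0 \<Rightarrow> n | Suc k \<Rightarrow> z k"]) simp
  qed (use Q(2) in blast)
  show ?thesis
    unfolding * by (rule Sigma11I) (simp only: case_prod_unfold closed_Collect_all[OF cl])
qed

lemma Sigma11_all:
  fixes P :: "'i::countable \<Rightarrow> 'a::topological_space \<Rightarrow> bool"
  assumes "\<And>i. boldface_Sigma11 {a. P i a}"
  shows "boldface_Sigma11 {a. \<forall>i. P i a}"
proof -
  have "(\<forall>i. P i a) \<longleftrightarrow> (\<forall>n. P (from_nat n) a)" for a
    by (metis from_nat_to_nat)
  then show ?thesis
    using Sigma11_all_nat[of "\<lambda>n. P (from_nat n)"] assms by simp
qed

lemma Sigma11_ex:
  fixes P :: "'i::countable \<Rightarrow> 'a::topological_space \<Rightarrow> bool"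
  assumes "\<And>i. boldface_Sigma11 {a. P i a}"
  shows "boldface_Sigma11 {a. \<exists>i. P i a}"
proof -
  have "(\<exists>i. P i a) \<longleftrightarrow> (\<exists>n. P (from_nat n) a)" for a
    by (metis from_nat_to_nat)
  then show ?thesis
    using Sigma11_ex_nat[of "\<lambda>n. P (from_nat n)"] assms by simp
qed

lemma Sigma11_conj:
  assumes "boldface_Sigma11 {a::'a::topological_space. P a}" "boldface_Sigma11 {a. Q a}"
  shows "boldface_Sigma11 {a. P a \<and> Q a}"
proof -
  have "boldface_Sigma11 {a. if i then P a else Q a}" for i
    using assms by (cases i) simp_all
  then have "boldface_Sigma11 {a. \<forall>i. if i then P a else Q a}"
    by (rule Sigma11_all)
  then show ?thesis
    by (simp add: all_bool_eq)
qed

lemma Sigma11_disj: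
  assumes "boldface_Sigma11 {a::'a::topological_space. P a}" "boldface_Sigma11 {a. Q a}"
  shows "boldface_Sigma11 {a. P a \<or> Q a}"
proof -
  have "boldface_Sigma11 {a. if i then P a else Q a}" for i
    using assms by (cases i) simp_all
  then have "boldface_Sigma11 {a. \<exists>i. if i then P a else Q a}"
    by (rule Sigma11_ex)
  then show ?thesis
    by (simp add: ex_bool_eq)
qed

section \<open>Bi-analytic predicates\<close>

text \<open>On Polish spaces these are the Borel predicates, by Suslin's theorem. Closure under
  negation and countable quantifiers lets complexity be read off a formula.\<close>

definition Delta11 :: "('a::topological_space \<Rightarrow> bool) \<Rightarrow> bool" where
  "Delta11 P \<longleftrightarrow> boldface_Sigma11 {a. P a} \<and> boldface_Sigma11 {a. \<not> P a}"

lemma Sigma11_Delta11: "Delta11 P \<Longrightarrow> boldface_Sigma11 {a. P a}"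
  by (simp add: Delta11_def)

lemma Delta11_clopen:
  "open {a. P a} \<Longrightarrow> closed {a. P a} \<Longrightarrow> Delta11 (\<lambda>a::'a::topological_space. P a)"
  by (simp add: Delta11_def Sigma11_closed closed_Collect_neg)

lemma Delta11_const: "Delta11 (\<lambda>a::'a::topological_space. P)"
  by (rule Delta11_clopen) auto

lemma Delta11_eq:
  fixes f :: "'a::topological_space \<Rightarrow> 'b::discrete_topology"
  shows "continuous_on UNIV f \<Longrightarrow> Delta11 (\<lambda>a. f a = k)"
  by (simp add: Delta11_clopen clopen_Collect_eq)

lemma Delta11_not: "Delta11 P \<Longrightarrow> Delta11 (\<lambda>a. \<not> P a)"
  by (simp add: Delta11_def)

lemma Delta11_conj:
  "Delta11 P \<Longrightarrow> Delta11 Q \<Longrightarrow> Delta11 (\<lambda>a. P a \<and> Q a)"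
  unfolding Delta11_def de_Morgan_conj
  by (elim conjE, intro conjI Sigma11_conj Sigma11_disj)

lemma Delta11_disj:
  "Delta11 P \<Longrightarrow> Delta11 Q \<Longrightarrow> Delta11 (\<lambda>a. P a \<or> Q a)"
  unfolding Delta11_def de_Morgan_disj
  by (elim conjE, intro conjI Sigma11_conj Sigma11_disj)

lemma Delta11_imp:
  "Delta11 P \<Longrightarrow> Delta11 Q \<Longrightarrow> Delta11 (\<lambda>a. P a \<longrightarrow> Q a)"
  unfolding imp_conv_disj by (intro Delta11_disj Delta11_not)

lemma Delta11_iff:
  "Delta11 P \<Longrightarrow> Delta11 Q \<Longrightarrow> Delta11 (\<lambda>a. P a \<longleftrightarrow> Q a)"
  unfolding iff_conv_conj_imp[abs_def] by (intro Delta11_conj Delta11_imp)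

lemma Delta11_all:
  "(\<And>i::'i::countable. Delta11 (P i)) \<Longrightarrow> Delta11 (\<lambda>a. \<forall>i. P i a)"
  by (simp add: Delta11_def Sigma11_all Sigma11_ex)

lemma Delta11_ex:
  "(\<And>i::'i::countable. Delta11 (P i)) \<Longrightarrow> Delta11 (\<lambda>a. \<exists>i. P i a)"
  by (simp add: Delta11_def Sigma11_all Sigma11_ex)

lemma Delta11_comp:
  "Delta11 P \<Longrightarrow> continuous_on UNIV f \<Longrightarrow> Delta11 (\<lambda>a. P (f a))"
  by (simp add: Delta11_def Sigma11_comp[of P f] Sigma11_comp[of "\<lambda>a. \<not> P a" f])

lemma Delta11_map_eq:
  fixes f :: "'a::topological_space \<Rightarrow> nat \<Rightarrow> 'b::discrete_topology"
  assumes "continuous_on UNIV f"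
  shows "Delta11 (\<lambda>a. map (f a) [0..<n] = p)"
proof -
  have *: "map (f a) [0..<n] = p \<longleftrightarrow> length p = n \<and> (\<forall>i. i < n \<longrightarrow> f a i = p ! i)" for a
    by (auto simp: list_eq_iff_nth_eq)
  have "Delta11 (\<lambda>a. f a i = k)" for i k
    by (rule Delta11_eq[OF continuous_on_product_then_coordinatewise[OF assms]])
  then show ?thesis
    unfolding * by (intro Delta11_conj Delta11_const Delta11_all Delta11_imp)
qed

subsection \<open>Comparing ranks by simulations\<close>

text \<open>The largest simulation. On accessible nodes it compares ordinal ranks; an inaccessible
  \<open>q\<close> lies above everything, as if its rank were infinite.\<close>

coinductive rank_le :: "('p \<Rightarrow> 'p \<Rightarrow> bool) \<Rightarrow> 'p \<Rightarrow> 'p \<Rightarrow> bool" for R where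
  "(\<And>p'. R p' p \<Longrightarrow> \<exists>q'. R q' q \<and> rank_le R p' q') \<Longrightarrow> rank_le R p q"

text \<open>The rank of \<open>q\<close> exceeds that of \<open>p\<close> exactly when some
  predecessor of \<open>q\<close> has rank at least that of \<open>p\<close>. An inaccessible node
  is strictly below itself, so irreflexivity holds only on the accessible part.\<close>

definition rank_lt :: "('p \<Rightarrow> 'p \<Rightarrow> bool) \<Rightarrow> 'p \<Rightarrow> 'p \<Rightarrow> bool" where
  "rank_lt R p q \<longleftrightarrow> (\<exists>q'. R q' q \<and> rank_le R p q')"

lemma rank_ltE:
  assumes "rank_lt R p q"
  obtains q' where "R q' q" "rank_le R p q'"
  using assms unfolding rank_lt_def by blast

lemma rank_leD: "rank_le R p q \<Longrightarrow> R p' p \<Longrightarrow> rank_lt R p' q"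
  unfolding rank_lt_def by (erule rank_le.cases) blast

lemma rank_leI: "(\<And>p'. R p' p \<Longrightarrow> rank_lt R p' q) \<Longrightarrow> rank_le R p q"
  unfolding rank_lt_def by (rule rank_le.intros) blast

lemma rank_le_coinduct:
  assumes "X p q" and step: "\<And>p q p'. X p q \<Longrightarrow> R p' p \<Longrightarrow> \<exists>q'. R q' q \<and> X p' q'"
  shows "rank_le R p q"
  using assms(1)
proof (rule rank_le.coinduct)
  fix p q assume "X p q"
  then have "\<forall>p'. R p' p \<longrightarrow> (\<exists>q'. R q' q \<and> X p' q')"
    by (simp add: step)
  then show "\<exists>p' q'. p = p' \<and> q = q' \<and>
      (\<forall>x. R x p' \<longrightarrow> (\<exists>y. R y q' \<and> (X x y \<or> rank_le R x y)))"
    by blast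
qed

lemma rank_le_iff_simulation:
  "rank_le R p q \<longleftrightarrow>
     (\<exists>S. S p q \<and> (\<forall>t u. S t u \<longrightarrow> (\<forall>t'. R t' t \<longrightarrow> (\<exists>u'. R u' u \<and> S t' u'))))"
proof
  assume "rank_le R p q"
  then show "\<exists>S. S p q \<and> (\<forall>t u. S t u \<longrightarrow> (\<forall>t'. R t' t \<longrightarrow> (\<exists>u'. R u' u \<and> S t' u')))"
    using rank_leD[of R] unfolding rank_lt_def by (intro exI[of _ "rank_le R"]) simp
next
  assume "\<exists>S. S p q \<and> (\<forall>t u. S t u \<longrightarrow> (\<forall>t'. R t' t \<longrightarrow> (\<exists>u'. R u' u \<and> S t' u')))"
  then obtain S where S: "S p q"
      "\<forall>t u. S t u \<longrightarrow> (\<forall>t'. R t' t \<longrightarrow> (\<exists>u'. R u' u \<and> S t' u'))"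
    by (elim exE conjE)
  show "rank_le R p q"
    by (rule rank_le_coinduct[of S, OF S(1)]) (simp add: S(2))
qed

lemma rank_le_refl: "rank_le R p p"
  unfolding rank_le_iff_simulation by (intro exI[of _ "(=)"]) simp

lemma rank_ltI: "R p q \<Longrightarrow> rank_lt R p q"
  using rank_le_refl rank_lt_def by metis

lemma rank_le_trans:
  assumes "rank_le R p q" "rank_le R q r"
  shows "rank_le R p r"
proof (rule rank_le_coinduct)
  show "\<exists>q. rank_le R p q \<and> rank_le R q r"
    using assms by (intro exI conjI)
next
  fix p r p' assume "\<exists>q. rank_le R p q \<and> rank_le R q r" and p': "R p' p"
  then obtain q where q: "rank_le R p q" "rank_le R q r"
    by (elim exE conjE)
  obtain q' where q': "R q' q" "rank_le R p' q'"
    by (rule rank_ltE[OF rank_leD[OF q(1) p']])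
  obtain r' where "R r' r" "rank_le R q' r'"
    by (rule rank_ltE[OF rank_leD[OF q(2) q'(1)]])
  with q'(2) show "\<exists>r'. R r' r \<and> (\<exists>q'. rank_le R p' q' \<and> rank_le R q' r')"
    by (intro exI conjI)
qed

lemma rank_le_lt_trans: "rank_le R p q \<Longrightarrow> rank_lt R q r \<Longrightarrow> rank_lt R p r"
  unfolding rank_lt_def by (elim exE conjE) (intro exI conjI, assumption, rule rank_le_trans)

lemma rank_lt_le_trans:
  assumes "rank_lt R p q" "rank_le R q r"
  shows "rank_lt R p r"
proof -
  obtain q' where q': "R q' q" "rank_le R p q'"
    using assms(1) by (rule rank_ltE)
  show ?thesis
    by (rule rank_le_lt_trans[OF q'(2) rank_leD[OF assms(2) q'(1)]])
qed

lemma accp_rank_le: "Wellfounded.accp R q \<Longrightarrow> rank_le R p q \<Longrightarrow> Wellfounded.accp R p"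
proof (induction q arbitrary: p rule: accp.induct)
  case (accI q)
  show ?case
  proof (rule accpI)
    fix p' assume "R p' p"
    from rank_leD[OF accI.prems this] obtain q' where "R q' q" "rank_le R p' q'"
      by (rule rank_ltE)
    then show "Wellfounded.accp R p'"
      by (rule accI.IH)
  qed
qed

lemma accp_rank_lt:
  assumes "Wellfounded.accp R q" "rank_lt R p q"
  shows "Wellfounded.accp R p"
proof -
  obtain q' where q': "R q' q" "rank_le R p q'"
    using assms(2) by (rule rank_ltE)
  show ?thesis
    by (rule accp_rank_le[OF accp_downward[OF assms(1) q'(1)] q'(2)])
qed

lemma rank_le_or_lt: "Wellfounded.accp R p \<Longrightarrow> rank_le R p q \<or> rank_lt R q p"
proof (induction p arbitrary: q rule: accp.induct)
  case (accI p)
  show ?case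
  proof (rule disjCI)
    assume nlt: "\<not> rank_lt R q p"
    show "rank_le R p q"
    proof (rule rank_leI)
      fix p' assume p': "R p' p"
      show "rank_lt R p' q"
      proof (rule ccontr)
        assume "\<not> rank_lt R p' q"
        \<comment> \<open>Failure of \<open>rank_lt R p' q\<close> means that no \<open>q'\<close>
          below \<open>q\<close> dominates \<open>p'\<close>, so the induction hypothesis for
          \<open>p'\<close> leaves only the strict alternative.\<close>
        then have "rank_lt R q' p'" if "R q' q" for q'
          using accI.IH[OF p', of q'] that \<open>\<not> rank_lt R p' q\<close> unfolding rank_lt_def[of R p' q] by simp
        then have "rank_le R q p'"
          by (rule rank_leI)
        then show False
          using nlt p' unfolding rank_lt_def by simp
      qed
    qed
  qed
qed

text \<open>The induction covers every \<open>q\<close> with \<open>rank_le R q p\<close>: a node of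
  rank below that of \<open>q\<close> is dominated by a predecessor of \<open>p\<close>, where the
  hypothesis applies.\<close>

lemma accp_accp_rank_lt: "Wellfounded.accp R p \<Longrightarrow> Wellfounded.accp (rank_lt R) p"
proof -
  have "rank_le R q p \<Longrightarrow> Wellfounded.accp (rank_lt R) q" if "Wellfounded.accp R p" for q
    using that
  proof (induction p arbitrary: q rule: accp.induct)
    case (accI p)
    show ?case
    proof (rule accp.accI)
      fix q' assume "rank_lt R q' q"
      then have "rank_lt R q' p"
        using accI.prems by (rule rank_lt_le_trans)
      then obtain p' where "R p' p" "rank_le R q' p'"
        by (rule rank_ltE)
      then show "Wellfounded.accp (rank_lt R) q'"
        by (rule accI.IH)
    qed
  qed
  then show "Wellfounded.accp R p \<Longrightarrow> Wellfounded.accp (rank_lt R) p"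
    using rank_le_refl[of R p] by simp
qed

lemma rank_le_not_lt:
  assumes "Wellfounded.accp R p" "rank_le R p q"
  shows "\<not> rank_lt R q p"
proof
  assume "rank_lt R q p"
  then have "rank_lt R p p"
    by (rule rank_le_lt_trans[OF assms(2)])
  moreover have "\<not> rank_lt R p p" if "Wellfounded.accp (rank_lt R) p"
    using that by (induction rule: accp.induct) metis
  ultimately show False
    using accp_accp_rank_lt[OF assms(1)] by simp
qed

text \<open>Replaces the well-ordering of the ordinals: descend along \<open>rank_lt\<close> from
  \<open>p\<close>; an accessible member with nothing of \<open>M\<close> strictly below it is least
  by comparability.\<close>

lemma rank_le_minimal:
  assumes "p \<in> M" "Wellfounded.accp R p"
  shows "\<exists>m\<in>M. \<forall>q\<in>M. rank_le R m q"
proof -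
  have "Wellfounded.accp (rank_lt R) p"
    using assms(2) by (rule accp_accp_rank_lt)
  then show ?thesis
    using assms
  proof (induction rule: accp.induct)
    case (accI p)
    show ?case
    proof (cases "\<exists>q\<in>M. rank_lt R q p")
      case True
      then show ?thesis
        using accI.IH accp_rank_lt[OF \<open>Wellfounded.accp R p\<close>] by auto
    next
      case False
      then show ?thesis
        using rank_le_or_lt[OF \<open>Wellfounded.accp R p\<close>] \<open>p \<in> M\<close> by auto
    qed
  qed
qed

subsection \<open>Choosing a canonical well-founded tree\<close>

text \<open>Pairing nodes with the real that defines the tree puts all trees into one relation, so
  \<open>rank_le\<close> can compare nodes of different trees.\<close>

definition child :: "('y \<Rightarrow> nat list \<Rightarrow> bool) \<Rightarrow> 'y \<times> nat list \<Rightarrow> 'y \<times> nat list \<Rightarrow> bool" where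
  "child T p q \<longleftrightarrow> fst p = fst q \<and> T (fst p) (snd p) \<and> (\<exists>k. snd p = snd q @ [k])"

lemma child_Pair [simp]:
  "child T (y, s) (z, u) \<longleftrightarrow> y = z \<and> T y s \<and> (\<exists>k. s = u @ [k])"
  by (auto simp: child_def)

text \<open>Since \<open>list_decode 0 = []\<close>, a comparison at index \<open>0\<close> compares whole trees.\<close>

abbreviation node_le where
  "node_le T n y z \<equiv> rank_le (child T) (y, list_decode n) (z, list_decode n)"

abbreviation node_lt where
  "node_lt T n y z \<equiv> rank_lt (child T) (y, list_decode n) (z, list_decode n)"

definition wf_tree :: "('y \<Rightarrow> nat list \<Rightarrow> bool) \<Rightarrow> 'y \<Rightarrow> bool" where
  "wf_tree T y \<longleftrightarrow> Wellfounded.accp (child T) (y, [])"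

text \<open>Lexicographic comparison of the sequences \<open>rank\<^sub>0, y 0, rank\<^sub>1, y 1, \<dots>\<close>, where \<open>rank\<^sub>n\<close> is
  the rank of the \<open>n\<close>-th node in the tree of \<open>y\<close>. The clause for \<open>i < n\<close> only asks for
  \<open>\<le>\<close>: a strict inequality there makes the comparison succeed at the index \<open>i\<close> already.\<close>

definition precedes :: "((nat \<Rightarrow> nat) \<Rightarrow> nat list \<Rightarrow> bool) \<Rightarrow> (nat \<Rightarrow> nat) \<Rightarrow> (nat \<Rightarrow> nat) \<Rightarrow> bool" where
  "precedes T y z \<longleftrightarrow> (\<exists>n. (\<forall>i<n. node_le T i y z \<and> y i = z i) \<and>
     (node_lt T n y z \<or> node_le T n y z \<and> y n < z n))"

text \<open>By \<open>precedes_wf_tree\<close>, letting \<open>z\<close> range over all reals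
  amounts to minimality among the well-founded trees, and it keeps the existential clause
  analytic.\<close>

definition selected :: "((nat \<Rightarrow> nat) \<Rightarrow> nat list \<Rightarrow> bool) \<Rightarrow> (nat \<Rightarrow> nat) \<Rightarrow> bool" where
  "selected T y \<longleftrightarrow> wf_tree T y \<and> \<not> (\<exists>z. precedes T z y)"

text \<open>Inside the tree, accessibility passes down from the root; a node outside has no children
  because \<open>T\<close> is closed under prefixes.\<close>

lemma wf_tree_accp:
  assumes "wf_tree T y" "\<And>s k. T y (s @ [k]) \<Longrightarrow> T y s"
  shows "Wellfounded.accp (child T) (y, s)"
proof (cases "T y s")
  case True
  then show ?thesis
  proof (induction s rule: rev_induct)
    case Nil
    then show ?case
      using assms(1) by (simp add: wf_tree_def)
  next
    case (snoc k s)
    then have "Wellfounded.accp (child T) (y, s)"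
      using assms(2) by blast
    then show ?case
      by (rule accp_downward) (use snoc.prems in simp)
  qed
next
  case False
  show ?thesis
    by (rule accpI) (use False assms(2) in \<open>auto simp: child_def\<close>)
qed

lemma not_wf_tree_iff_branch:
  assumes "\<And>s k. T y (s @ [k]) \<Longrightarrow> T y s"
  shows "\<not> wf_tree T y \<longleftrightarrow> (\<exists>z. \<forall>n. T y (map z [0..<n]))"
proof
  assume nwf: "\<not> wf_tree T y"
  \<comment> \<open>A bad node has a bad child in the tree. Choosing one repeatedly from the root
    gives \<open>S n\<close>, the initial segment of length \<open>n\<close> of a branch.\<close>
  define bad where "bad s \<longleftrightarrow> \<not> Wellfounded.accp (child T) (y, s)" for s
  have step: "\<exists>k. T y (s @ [k]) \<and> bad (s @ [k])" if "bad s" for s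
    using that accp.accI[of "child T" "(y, s)"] unfolding bad_def child_def by fastforce
  define ext where "ext s = (SOME k. T y (s @ [k]) \<and> bad (s @ [k]))" for s
  define S where "S = rec_nat [] (\<lambda>n s. s @ [ext s])"
  have S: "S 0 = []" "S (Suc n) = S n @ [ext (S n)]" for n
    by (simp_all add: S_def)
  have bad: "bad (S n)" for n
  proof (induction n)
    case 0
    then show ?case
      using nwf by (simp add: S bad_def wf_tree_def)
  next
    case (Suc n)
    then show ?case
      using someI_ex[OF step[OF Suc]] by (simp add: S ext_def)
  qed
  have T_S: "T y (S n)" for n
    using someI_ex[OF step[OF bad[of n]]] assms by (metis ext_def)
  have "S n = map (\<lambda>i. ext (S i)) [0..<n]" for n
    by (induction n) (simp_all add: S)
  then show "\<exists>z. \<forall>n. T y (map z [0..<n])"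
    using T_S by metis
next
  assume "\<exists>z. \<forall>n. T y (map z [0..<n])"
  then obtain z where z: "\<And>n. T y (map z [0..<n])"
    by blast
  have "p \<noteq> (y, map z [0..<n])" if "Wellfounded.accp (child T) p" for p n
    using that
  proof (induction arbitrary: n rule: accp.induct)
    case (accI p)
    then show ?case
      using accI.IH[of "(y, map z [0..<Suc n])" "Suc n"] z[of "Suc n"] by auto
  qed
  from this[of "(y, [])" 0] show "\<not> wf_tree T y"
    by (auto simp: wf_tree_def)
qed

lemma precedes_wf_tree:
  assumes "precedes T y z" "wf_tree T z"
  shows "wf_tree T y"
proof -
  obtain n where n: "\<forall>i<n. node_le T i y z \<and> y i = z i"
      "node_lt T n y z \<or> node_le T n y z \<and> y n < z n"
    using assms(1) unfolding precedes_def by blast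
  then have "node_le T 0 y z \<or> node_lt T 0 y z"
    by (cases n) auto
  then show ?thesis
    using assms(2) accp_rank_le accp_rank_lt unfolding wf_tree_def by fastforce
qed

text \<open>Neither real precedes the other, so comparability forces equal ranks and values, index
  by index.\<close>

lemma selected_unique:
  assumes prefix: "\<And>y s k. T y (s @ [k]) \<Longrightarrow> T y s"
    and sel: "selected T y" "selected T z"
  shows "y = z"
proof
  fix n
  have acc: "Wellfounded.accp (child T) (y, s)" "Wellfounded.accp (child T) (z, s)" for s
    using sel wf_tree_accp prefix unfolding selected_def by metis+
  have np: "\<not> precedes T y z" "\<not> precedes T z y"
    using sel unfolding selected_def by blast+
  have "node_le T n y z \<and> node_le T n z y \<and> y n = z n"
  proof (induction n rule: less_induct)
    case (less n)
    have "\<not> node_lt T n y z" "\<not> node_lt T n z y"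
      using np less unfolding precedes_def by metis+
    then have le: "node_le T n y z" "node_le T n z y"
      using rank_le_or_lt acc by metis+
    moreover have "\<not> y n < z n" "\<not> z n < y n"
      using np less le unfolding precedes_def by metis+
    ultimately show ?case
      by simp
  qed
  then show "y n = z n"
    by blast
qed

text \<open>The sets \<open>A n\<close> keep the \<open>y\<close> whose sequence \<open>rank\<^sub>0, y 0, \<dots>, rank\<^sub>n\<^sub>-\<^sub>1, y (n - 1)\<close> is
  lexicographically least. They determine a limit \<open>v\<close>, and sending each node \<open>s\<close> of the tree of \<open>v\<close>
  to the node \<open>s\<close> of a tree in a late \<open>A n\<close> preserves rank comparisons, because the ranks at
  \<open>s\<close> have stabilised. Hence the tree of \<open>v\<close> is well-founded with the least ranks.\<close>

lemma selected_exists: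
  assumes prefix: "\<And>y s k. T y (s @ [k]) \<Longrightarrow> T y s"
    and local: "\<And>y z s. (\<And>i. i < length s \<Longrightarrow> y i = z i) \<Longrightarrow> T y s \<Longrightarrow> T z s"
    and wf: "wf_tree T y\<^sub>0"
  shows "\<exists>v. selected T v"
proof -
  define A where "A = rec_nat {y. wf_tree T y} (\<lambda>n B. {y \<in> B. \<forall>z\<in>B. node_le T n y z \<and>
     (node_le T n z y \<longrightarrow> y n \<le> z n)})"
  have A0: "A 0 = {y. wf_tree T y}"
    and A_Suc: "A (Suc n) = {y \<in> A n. \<forall>z\<in>A n. node_le T n y z \<and> (node_le T n z y \<longrightarrow> y n \<le> z n)}" for n
    by (simp_all add: A_def)
  have A_SucI: "y \<in> A (Suc n)" if "y \<in> A n" "\<And>z. z \<in> A n \<Longrightarrow> node_le T n y z"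
      "\<And>z. z \<in> A n \<Longrightarrow> node_le T n z y \<Longrightarrow> y n \<le> z n" for y n
    using that unfolding A_Suc by simp
  have A_SucD: "y \<in> A n" "node_le T n y z" "node_le T n z y \<Longrightarrow> y n \<le> z n"
    if "y \<in> A (Suc n)" "z \<in> A n" for y z n
    using that unfolding A_Suc by simp_all
  have A_mono: "A n \<subseteq> A m" if "m \<le> n" for m n
    by (rule lift_Suc_antimono_le[OF _ that]) (simp only: A_Suc Collect_restrict)
  have acc: "Wellfounded.accp (child T) (y, s)" if "y \<in> A n" for y n s
  proof (rule wf_tree_accp)
    show "wf_tree T y"
      using that A_mono[of 0 n] A0 by auto
  qed (rule prefix)
  have "A n \<noteq> {}" for n
  proof (induction n)
    case 0
    then show ?case
      using wf A0 by blast
  next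
    case (Suc n)
    then obtain y where "y \<in> A n"
      by blast
    then obtain m where m: "m \<in> A n" "\<forall>z\<in>A n. node_le T n m z"
      using rank_le_minimal[of "(y, list_decode n)" "(\<lambda>y. (y, list_decode n)) ` A n" "child T"] acc
      by auto
    define k where "k = (LEAST k. \<exists>y\<in>A n. node_le T n y m \<and> y n = k)"
    have "\<exists>y\<in>A n. node_le T n y m \<and> y n = k"
      unfolding k_def by (rule LeastI[of _ "m n"]) (use m rank_le_refl in blast)
    then obtain y where y: "y \<in> A n" "node_le T n y m" "y n = k"
      by blast
    have "y \<in> A (Suc n)"
    proof (rule A_SucI)
      fix z assume z: "z \<in> A n"
      show "node_le T n y z"
        by (rule rank_le_trans[OF y(2) bspec[OF m(2) z]])
      assume "node_le T n z y"
      then have "node_le T n z m"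
        using y(2) by (rule rank_le_trans)
      then show "y n \<le> z n"
        unfolding y(3) k_def by (intro Least_le) (use z in auto)
    qed (rule y(1))
    then show ?case
      by auto
  qed
  then have "\<forall>n. \<exists>y. y \<in> A n"
    by auto
  from choice[OF this] obtain Y where "\<forall>n. Y n \<in> A n" ..
  then have Y: "Y n \<in> A n" for n
    by simp
  \<comment> \<open>At stage \<open>Suc n\<close> all survivors share the value at \<open>n\<close>,
    so this limit does not depend on the choice of \<open>Y\<close>.\<close>
  define v where "v n = Y (Suc n) n" for n
  have A_le: "y \<in> A m" if "y \<in> A n" "m \<le> n" for y m n
    using A_mono[OF that(2)] that(1) by auto
  have agree: "node_le T n y z" "y n = z n" if "y \<in> A (Suc n)" "z \<in> A (Suc n)" for y z n
  proof -
    have yz: "y \<in> A n" "z \<in> A n"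
      using that A_le by auto
    show "node_le T n y z"
      using that(1) yz(2) by (rule A_SucD)
    then have "z n \<le> y n"
      by (rule A_SucD(3)[OF that(2) yz(1)])
    moreover have "y n \<le> z n"
      by (rule A_SucD(3)[OF that(1) yz(2)]) (rule A_SucD(2)[OF that(2) yz(1)])
    ultimately show "y n = z n"
      by simp
  qed
  have Y_A: "Y m \<in> A (Suc n)" if "n < m" for m n
    using that by (intro A_le[OF Y]) simp
  have Y_v: "Y m n = v n" if "n < m" for m n
    unfolding v_def by (rule agree(2)) (use Y Y_A[OF that] in auto)
  \<comment> \<open>By stage \<open>Suc (list_encode s)\<close> the rank at \<open>s\<close> has
    reached its final value.\<close>
  define g where "g s = (Y (Suc (list_encode s)), s)" for s
  have g_le: "rank_le (child T) (g s) (Y m, s)" "rank_le (child T) (Y m, s) (g s)"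
    if "list_encode s < m" for s m
    using agree(1)[OF Y Y_A[OF that]] agree(1)[OF Y_A[OF that] Y] unfolding g_def by simp_all
  have acc_g: "Wellfounded.accp (child T) (g s)" for s
    unfolding g_def by (rule acc[OF Y])
  have g_lt: "rank_lt (child T) (g (s @ [k])) (g s)" if "T v (s @ [k])" for s k
  proof -
    \<comment> \<open>Late enough for \<open>Y m\<close> to agree with \<open>v\<close> along
      \<open>s @ [k]\<close> and for the ranks at both nodes to be final.\<close>
    define m where "m = Suc (max (length (s @ [k])) (max (list_encode s) (list_encode (s @ [k]))))"
    have "T (Y m) (s @ [k])"
      by (rule local[OF _ that]) (simp add: Y_v m_def)
    then have "child T (Y m, s @ [k]) (Y m, s)"
      by simp
    then have "rank_lt (child T) (Y m, s @ [k]) (Y m, s)"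
      by (rule rank_ltI)
    then have "rank_lt (child T) (Y m, s @ [k]) (g s)"
      by (rule rank_lt_le_trans) (rule g_le, simp add: m_def)
    then show ?thesis
      by (rule rank_le_lt_trans[rotated]) (rule g_le, simp add: m_def)
  qed
  \<comment> \<open>The map \<open>g\<close> turns children in the tree of \<open>v\<close> into
    strict rank decreases, so accessibility is inherited from \<open>rank_lt\<close>.\<close>
  have "Wellfounded.accp (child T) (v, s)" if "Wellfounded.accp (rank_lt (child T)) p" "p = g s" for p s
    using that
  proof (induction arbitrary: s rule: accp.induct)
    case (accI p)
    show ?case
    proof (rule accpI)
      fix q assume "child T q (v, s)"
      then obtain k where k: "q = (v, s @ [k])" "T v (s @ [k])"
        by (auto simp: child_def prod_eq_iff)
      show "Wellfounded.accp (child T) q"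
        unfolding k(1) using g_lt[OF k(2)] accI.prems by (intro accI.IH[OF _ refl]) simp
    qed
  qed
  then have "wf_tree T v"
    unfolding wf_tree_def using accp_accp_rank_lt[OF acc_g] by simp
  \<comment> \<open>The simulation relates \<open>(v, t)\<close> to every node dominating
    \<open>g t\<close>; hence the ranks of \<open>v\<close> do not exceed the limiting ones.\<close>
  have v_le_g: "rank_le (child T) (v, s) (g s)" for s
  proof -
    have "\<exists>t. (v, s) = (v, t) \<and> rank_le (child T) (g t) (g s)"
      using rank_le_refl by simp
    then show ?thesis
    proof (rule rank_le_coinduct)
      fix p q p' assume "\<exists>t. p = (v, t) \<and> rank_le (child T) (g t) q" and "child T p' p"
      then obtain t k where t: "rank_le (child T) (g t) q" "p' = (v, t @ [k])" "T v (t @ [k])"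
        by (auto simp: child_def prod_eq_iff)
      have "rank_lt (child T) (g (t @ [k])) q"
        by (rule rank_lt_le_trans[OF g_lt[OF t(3)] t(1)])
      then show "\<exists>q'. child T q' q \<and> (\<exists>t. p' = (v, t) \<and> rank_le (child T) (g t) q')"
        unfolding rank_lt_def t(2) by blast
    qed
  qed
  have v_le: "node_le T n v (Y (Suc n))" for n
    using v_le_g[of "list_decode n"] by (simp add: g_def)
  have v_A: "v \<in> A n" for n
  proof (induction n)
    case 0
    then show ?case
      using \<open>wf_tree T v\<close> A0 by simp
  next
    case (Suc n)
    show ?case
    proof (rule A_SucI[OF Suc])
      fix z assume z: "z \<in> A n"
      show "node_le T n v z"
        using v_le A_SucD(2)[OF Y z] by (rule rank_le_trans)
      assume "node_le T n z v"
      then have "node_le T n z (Y (Suc n))"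
        using v_le by (rule rank_le_trans)
      then show "v n \<le> z n"
        unfolding v_def by (rule A_SucD(3)[OF Y z])
    qed
  qed
  have "\<not> precedes T z v" for z
  proof
    assume "precedes T z v"
    then obtain n where n: "\<And>i. i < n \<Longrightarrow> node_le T i z v \<and> z i = v i"
        "node_lt T n z v \<or> node_le T n z v \<and> z n < v n"
      unfolding precedes_def by blast
    have "wf_tree T z"
      using \<open>precedes T z v\<close> \<open>wf_tree T v\<close> by (rule precedes_wf_tree)
    \<comment> \<open>A real preceding \<open>v\<close> would survive all stages up to
      \<open>n\<close>, where the minimality of \<open>v\<close> in \<open>A n\<close> rules out an
      improvement.\<close>
    have "z \<in> A i" if "i \<le> n" for i
      using that
    proof (induction i)
      case 0
      then show ?case
        using \<open>wf_tree T z\<close> A0 by simp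
    next
      case (Suc i)
      then have z: "z \<in> A i" "node_le T i z v" "z i = v i"
        using n(1) by simp_all
      show ?case
      proof (rule A_SucI[OF z(1)])
        fix u assume u: "u \<in> A i"
        show "node_le T i z u"
          using z(2) A_SucD(2)[OF v_A u] by (rule rank_le_trans)
        assume "node_le T i u z"
        then have "node_le T i u v"
          using z(2) by (rule rank_le_trans)
        then show "z i \<le> u i"
          unfolding z(3) by (rule A_SucD(3)[OF v_A u])
      qed
    qed
    then have "node_le T n v z" "node_le T n z v \<longrightarrow> v n \<le> z n"
      using A_SucD[OF v_A] by auto
    then show False
      using n(2) rank_le_not_lt[OF acc[OF v_A]] by auto
  qed
  then show ?thesis
    using \<open>wf_tree T v\<close> selected_def by blast
qed

section \<open>Definability of the rank comparisons\<close>

lemma tendsto_funI: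
  fixes f :: "'c \<Rightarrow> 'a \<Rightarrow> 'b::topological_space"
  assumes "\<And>i. ((\<lambda>n. f n i) \<longlongrightarrow> l i) F"
  shows "(f \<longlongrightarrow> l) F"
proof -
  have "limitin (product_topology (\<lambda>i. euclidean) UNIV) f l F"
    unfolding limitin_componentwise using assms by simp
  then show ?thesis
    by (simp add: euclidean_product_topology)
qed

text \<open>The zero set of \<open>f\<close> codes the simulation. Both first components stay fixed
  along \<open>child\<close>, so a relation between lists suffices and the only quantifier over
  reals is existential.\<close>

lemma rank_le_child_iff:
  "rank_le (child T) (y, s) (z, u) \<longleftrightarrow> (\<exists>f :: nat \<Rightarrow> nat.
     f (prod_encode (list_encode s, list_encode u)) = 0 \<and>
     (\<forall>t w k. f (prod_encode (list_encode t, list_encode w)) = 0 \<longrightarrow> T y (t @ [k]) \<longrightarrow>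
       (\<exists>l. T z (w @ [l]) \<and> f (prod_encode (list_encode (t @ [k]), list_encode (w @ [l]))) = 0)))"
    (is "_ \<longleftrightarrow> (\<exists>f. ?sim f)")
proof
  assume le: "rank_le (child T) (y, s) (z, u)"
  define f :: "nat \<Rightarrow> nat" where "f m = (case prod_decode m of (a, b) \<Rightarrow>
    if rank_le (child T) (y, list_decode a) (z, list_decode b) then 0 else 1)" for m
  have f: "f (prod_encode (list_encode t, list_encode w)) = 0 \<longleftrightarrow> rank_le (child T) (y, t) (z, w)" for t w
    by (simp add: f_def)
  have "\<exists>l. T z (w @ [l]) \<and> rank_le (child T) (y, t @ [k]) (z, w @ [l])"
    if "rank_le (child T) (y, t) (z, w)" "T y (t @ [k])" for t w k
  proof -
    have "child T (y, t @ [k]) (y, t)"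
      using that(2) by simp
    from rank_leD[OF that(1) this] obtain q
      where "child T q (z, w)" "rank_le (child T) (y, t @ [k]) q"
      by (rule rank_ltE)
    then show ?thesis
      by (cases q) auto
  qed
  then have "?sim f"
    using le unfolding f by simp
  then show "\<exists>f. ?sim f"
    by (rule exI[where P = ?sim])
next
  assume "\<exists>f. ?sim f"
  then obtain f where f: "?sim f"
    by (elim exE)
  show "rank_le (child T) (y, s) (z, u)"
  proof (rule rank_le_coinduct)
    show "\<exists>t w. (y, s) = (y, t) \<and> (z, u) = (z, w) \<and>
        f (prod_encode (list_encode t, list_encode w)) = 0"
      using f by simp
  next
    fix p q p' assume "\<exists>t w. p = (y, t) \<and> q = (z, w) \<and>
        f (prod_encode (list_encode t, list_encode w)) = 0" and "child T p' p"
    then obtain t w k where *: "q = (z, w)" "f (prod_encode (list_encode t, list_encode w)) = 0"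
        "p' = (y, t @ [k])" "T y (t @ [k])"
      by (auto simp: child_def prod_eq_iff)
    then obtain l where "T z (w @ [l])"
        "f (prod_encode (list_encode (t @ [k]), list_encode (w @ [l]))) = 0"
      using f[THEN conjunct2, rule_format, OF *(2) *(4)] by (elim exE conjE)
    then show "\<exists>q'. child T q' q \<and> (\<exists>t w. p' = (y, t) \<and> q' = (z, w) \<and>
        f (prod_encode (list_encode t, list_encode w)) = 0)"
      using * by (intro exI[of _ "(z, w @ [l])"]) auto
  qed
qed

lemma continuous_on_snd_apply: "continuous_on UNIV (\<lambda>p::'a::topological_space \<times> (nat \<Rightarrow> 'b::topological_space). snd p i)"
  by (rule continuous_on_product_then_coordinatewise[OF continuous_on_snd[OF continuous_on_id]])

lemma Delta11_fst: "Delta11 P \<Longrightarrow> Delta11 (\<lambda>p. P (fst p))"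
  by (rule Delta11_comp[OF _ continuous_on_fst[OF continuous_on_id]])

lemma Sigma11_rank_le:
  fixes y z :: "'a::topological_space \<Rightarrow> 'y"
  assumes "\<And>s. Delta11 (\<lambda>a. T a (y a) s)" "\<And>s. Delta11 (\<lambda>a. T a (z a) s)"
  shows "boldface_Sigma11 {a. rank_le (child (T a)) (y a, s) (z a, u)}"
  unfolding rank_le_child_iff
  by (intro Sigma11_ex_real Sigma11_Delta11 Delta11_conj Delta11_all Delta11_ex Delta11_imp
      Delta11_eq continuous_on_snd_apply Delta11_fst[OF assms(1)] Delta11_fst[OF assms(2)])

lemma Sigma11_rank_lt:
  fixes y z :: "'a::topological_space \<Rightarrow> 'y"
  assumes "\<And>s. Delta11 (\<lambda>a. T a (y a) s)" "\<And>s. Delta11 (\<lambda>a. T a (z a) s)"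
  shows "boldface_Sigma11 {a. rank_lt (child (T a)) (y a, s) (z a, u)}"
proof -
  have "rank_lt (child (T a)) (y a, s) (z a, u) \<longleftrightarrow>
      (\<exists>l. T a (z a) (u @ [l]) \<and> rank_le (child (T a)) (y a, s) (z a, u @ [l]))" for a
    unfolding rank_lt_def by (auto simp: child_def)
  then show ?thesis
    using Sigma11_ex[OF Sigma11_conj[OF Sigma11_Delta11[OF assms(2)] Sigma11_rank_le[of T y z, OF assms]]]
    by simp
qed

lemma Delta11_rel_nat:
  fixes f g :: "'a::topological_space \<Rightarrow> nat"
  assumes "continuous_on UNIV f" "continuous_on UNIV g"
  shows "Delta11 (\<lambda>a. R (f a) (g a))"
proof -
  have "Delta11 (\<lambda>a. \<exists>j k. (f a = j \<and> g a = k) \<and> R j k)"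
    by (intro Delta11_ex Delta11_conj Delta11_const Delta11_eq assms)
  then show ?thesis
    by simp
qed

text \<open>Rank comparisons occur only positively in \<open>precedes\<close>, so their analyticity
  is enough.\<close>

lemma Sigma11_precedes:
  fixes y z :: "'a::topological_space \<Rightarrow> nat \<Rightarrow> nat"
  assumes T: "\<And>s. Delta11 (\<lambda>a. T a (y a) s)" "\<And>s. Delta11 (\<lambda>a. T a (z a) s)"
    and c: "continuous_on UNIV y" "continuous_on UNIV z"
  shows "boldface_Sigma11 {a. precedes (T a) (y a) (z a)}"
proof -
  have rel: "Delta11 (\<lambda>a. R (y a i) (z a i))" for R i
    by (rule Delta11_rel_nat[OF continuous_on_product_then_coordinatewise[OF c(1)]
          continuous_on_product_then_coordinatewise[OF c(2)]])
  note le = Sigma11_rank_le[of T y z, OF T] and lt = Sigma11_rank_lt[of T y z, OF T]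
  have below: "boldface_Sigma11 {a. i < n \<longrightarrow> node_le (T a) i (y a) (z a) \<and> y a i = z a i}" for i n
    using Sigma11_conj[OF le Sigma11_Delta11[OF rel]] Sigma11_Delta11[OF Delta11_const[of True]]
    by (cases "i < n") simp_all
  show ?thesis
    unfolding precedes_def
    by (rule Sigma11_ex, rule Sigma11_conj[OF Sigma11_all[OF below]],
        rule Sigma11_disj[OF lt Sigma11_conj[OF le Sigma11_Delta11[OF rel]]])
qed

subsection \<open>Uniformization of coanalytic sets\<close>

definition agrees :: "nat \<Rightarrow> ((nat \<Rightarrow> 'b) \<times> (nat \<Rightarrow> nat)) \<times> (nat \<Rightarrow> nat) \<Rightarrow>
    (nat \<Rightarrow> 'b) \<Rightarrow> (nat \<Rightarrow> nat) \<Rightarrow> nat list \<Rightarrow> bool" where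
  "agrees n c x y s \<longleftrightarrow> map (fst (fst c)) [0..<n] = map x [0..<n] \<and>
     map (snd (fst c)) [0..<n] = map y [0..<n] \<and> map (snd c) [0..<n] = s"

text \<open>Members agreeing with the point on ever longer segments converge to it, since every
  coordinate is eventually constant; closedness catches the limit.\<close>

lemma closed_mem_iff_agrees:
  fixes C :: "(((nat \<Rightarrow> 'b::topological_space) \<times> (nat \<Rightarrow> nat)) \<times> (nat \<Rightarrow> nat)) set"
  assumes "closed C"
  shows "((x, y), z) \<in> C \<longleftrightarrow> (\<forall>n. \<exists>c\<in>C. agrees n c x y (map z [0..<n]))"
proof
  assume "((x, y), z) \<in> C"
  then show "\<forall>n. \<exists>c\<in>C. agrees n c x y (map z [0..<n])"
    by (intro allI bexI[of _ "((x, y), z)"]) (simp_all add: agrees_def)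
next
  assume "\<forall>n. \<exists>c\<in>C. agrees n c x y (map z [0..<n])"
  then have "\<forall>n. \<exists>c. c \<in> C \<and> agrees n c x y (map z [0..<n])"
    unfolding Bex_def .
  from choice[OF this] obtain c where c: "\<forall>n. c n \<in> C \<and> agrees n (c n) x y (map z [0..<n])" ..
  have ev: "eventually (\<lambda>n. fst (fst (c n)) i = x i \<and> snd (fst (c n)) i = y i \<and> snd (c n) i = z i)
      sequentially" for i
    using c unfolding agrees_def by (intro eventually_sequentiallyI[of "Suc i"]) (simp add: Suc_le_eq)
  have "(\<lambda>n. fst (fst (c n))) \<longlonglongrightarrow> x"
    by (rule tendsto_funI, rule tendsto_eventually) (use ev in \<open>simp add: eventually_conj_iff\<close>)
  moreover have "(\<lambda>n. snd (fst (c n))) \<longlonglongrightarrow> y"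
    by (rule tendsto_funI, rule tendsto_eventually) (use ev in \<open>simp add: eventually_conj_iff\<close>)
  moreover have "(\<lambda>n. snd (c n)) \<longlonglongrightarrow> z"
    by (rule tendsto_funI, rule tendsto_eventually) (use ev in \<open>simp add: eventually_conj_iff\<close>)
  ultimately have "(\<lambda>n. ((fst (fst (c n)), snd (fst (c n))), snd (c n))) \<longlonglongrightarrow> ((x, y), z)"
    by (intro tendsto_Pair)
  then have "c \<longlonglongrightarrow> ((x, y), z)"
    by simp
  then show "((x, y), z) \<in> C"
    by (rule Lim_in_closed_set[OF assms _ sequentially_bot, rotated]) (simp add: c)
qed

text \<open>Kondo's theorem. The tree given by \<open>T x\<close> at \<open>y\<close> searches for a
  witness that \<open>(x, y)\<close> lies outside \<open>P\<close>, so it is well-founded exactly on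
  \<open>P\<close>.\<close>

theorem Pi11_uniformization:
  fixes P :: "((nat \<Rightarrow> 'b::{countable, discrete_topology}) \<times> (nat \<Rightarrow> nat)) set"
  assumes "boldface_Pi11 P"
  shows "\<exists>Q :: ((nat \<Rightarrow> 'b) \<times> (nat \<Rightarrow> nat)) set. boldface_Pi11 Q \<and> fst ` Q = fst ` P \<and>
    (\<forall>x y z. (x, y) \<in> Q \<longrightarrow> (x, z) \<in> Q \<longrightarrow> y = z)"
proof -
  obtain C :: "(((nat \<Rightarrow> 'b) \<times> (nat \<Rightarrow> nat)) \<times> (nat \<Rightarrow> nat)) set"
    where C: "closed C" "- P = fst ` C"
    using assms unfolding boldface_Pi11_def boldface_Sigma11_def by blast
  define T where "T x y s \<longleftrightarrow> (\<exists>c\<in>C. agrees (length s) c x y s)" for x y and s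
  have prefix: "T x y s" if "T x y (s @ [k])" for x y s k
    using that unfolding T_def agrees_def by auto
  have local: "T x z s" if "\<And>i. i < length s \<Longrightarrow> y i = z i" "T x y s" for x y z s
  proof -
    have "map y [0..<length s] = map z [0..<length s]"
      using that(1) by simp
    then show ?thesis
      using that(2) unfolding T_def agrees_def by simp
  qed
  have wf: "wf_tree (T x) y \<longleftrightarrow> (x, y) \<in> P" for x y
  proof -
    have "\<not> wf_tree (T x) y \<longleftrightarrow> (\<exists>z. \<forall>n. T x y (map z [0..<n]))"
      by (rule not_wf_tree_iff_branch) (rule prefix)
    also have "\<dots> \<longleftrightarrow> (\<exists>z. ((x, y), z) \<in> C)"
      unfolding closed_mem_iff_agrees[OF C(1)] T_def by simp
    also have "\<dots> \<longleftrightarrow> (x, y) \<in> - P"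
      unfolding C(2) by force
    finally show ?thesis
      by simp
  qed
  have Delta_T: "Delta11 (\<lambda>a. T (f a) (g a) s)"
    if "continuous_on UNIV f" "continuous_on UNIV g"
    for f :: "((nat \<Rightarrow> 'b) \<times> (nat \<Rightarrow> nat)) \<times> (nat \<Rightarrow> nat) \<Rightarrow> nat \<Rightarrow> 'b" and g s
  proof -
    let ?n = "length s"
    \<comment> \<open>\<open>T\<close> depends on finite segments only. Once these are fixed as
      \<open>p\<close> and \<open>q\<close>, the condition on \<open>C\<close> is a constant, and
      the rest is a countable disjunction.\<close>
    have *: "T (f a) (g a) s \<longleftrightarrow> (\<exists>p q. map (f a) [0..<?n] = p \<and> map (g a) [0..<?n] = q \<and>
      (\<exists>c\<in>C. map (fst (fst c)) [0..<?n] = p \<and> map (snd (fst c)) [0..<?n] = q \<and>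
        map (snd c) [0..<?n] = s))" for a
      unfolding T_def agrees_def by simp
    show ?thesis
      unfolding * by (intro Delta11_ex Delta11_conj Delta11_const Delta11_map_eq that)
  qed
  define Q where "Q = {p. selected (T (fst p)) (snd p)}"
  have "boldface_Sigma11 {p. \<exists>z. precedes (T (fst p)) z (snd p)}"
    by (intro Sigma11_ex_real Sigma11_precedes Delta_T continuous_on_fst continuous_on_snd
        continuous_on_id)
  moreover have "boldface_Sigma11 {p. p \<in> - P}"
    using assms by (simp add: boldface_Pi11_def Collect_mem_eq del: Compl_iff)
  ultimately have "boldface_Sigma11 {p. p \<in> - P \<or> (\<exists>z. precedes (T (fst p)) z (snd p))}"
    by (rule Sigma11_disj[rotated])
  also have "{p. p \<in> - P \<or> (\<exists>z. precedes (T (fst p)) z (snd p))} = - Q"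
    unfolding Q_def selected_def by (auto simp: wf)
  finally have 1: "boldface_Pi11 Q"
    unfolding boldface_Pi11_def .
  have 2: "fst ` Q = fst ` P"
  proof
    show "fst ` Q \<subseteq> fst ` P"
      unfolding Q_def selected_def by (auto simp: wf)
    show "fst ` P \<subseteq> fst ` Q"
    proof
      fix x assume "x \<in> fst ` P"
      then obtain y where "wf_tree (T x) y"
        by (auto simp: wf)
      then have "\<exists>v. selected (T x) v"
        by (intro selected_exists[of "T x" y]) (auto intro: prefix local)
      then obtain v where "(x, v) \<in> Q"
        unfolding Q_def by auto
      then show "x \<in> fst ` Q"
        by force
    qed
  qed
  have 3: "y = z" if "(x, y) \<in> Q" "(x, z) \<in> Q" for x y z
    using that prefix unfolding Q_def by (intro selected_unique[of "T x"]) simp_all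
  show ?thesis
    by (intro exI[of _ Q] conjI allI impI 1 2 3)
qed

section \<open>Coanalytic codes for a Sigma^1_2 set\<close>

text \<open>Half of a coding of pairs by one real: the parities of \<open>h\<close> give a point of
  Cantor space, the values \<open>h i div 2\<close> a point of Baire space.\<close>

definition parity :: "(nat \<Rightarrow> nat) \<Rightarrow> nat \<Rightarrow> bool" where
  "parity h n \<longleftrightarrow> odd (h n)"

lemma continuous_on_postcomp:
  fixes r :: "nat \<Rightarrow> 'b::topological_space"
  shows "continuous_on UNIV (\<lambda>h::nat \<Rightarrow> nat. \<lambda>i. r (h i))"
proof (rule continuous_on_coordinatewise_then_product)
  fix i
  show "continuous_on UNIV (\<lambda>h::nat \<Rightarrow> nat. r (h i))"
    by (rule continuous_on_compose2[OF Topological_Spaces.continuous_on_discrete[of UNIV r]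
          continuous_on_product_then_coordinatewise[OF continuous_on_id]]) simp
qed

text \<open>Uniformization leaves one witness per element of \<open>A\<close>, so a code of element
  and witness is determined by its parities.\<close>

lemma Sigma12_injective_parity_image:
  assumes "boldface_Sigma12 A"
  obtains H where "boldface_Pi11 H" "inj_on parity H" "parity ` H = A"
proof -
  obtain P :: "((nat \<Rightarrow> bool) \<times> (nat \<Rightarrow> nat)) set" where P: "boldface_Pi11 P" "A = fst ` P"
    using assms unfolding boldface_Sigma12_def by blast
  obtain Q :: "((nat \<Rightarrow> bool) \<times> (nat \<Rightarrow> nat)) set" where Q: "boldface_Pi11 Q" "fst ` Q = fst ` P"
      "\<forall>x y z. (x, y) \<in> Q \<longrightarrow> (x, z) \<in> Q \<longrightarrow> y = z"
    using Pi11_uniformization[OF P(1)] by (elim exE conjE)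
  define H where "H = {h. (parity h, \<lambda>i. h i div 2) \<in> Q}"
  have cont: "continuous_on UNIV (\<lambda>h. (parity h, \<lambda>i. h i div 2))"
    unfolding parity_def[abs_def] by (intro continuous_on_Pair continuous_on_postcomp)
  have "boldface_Sigma11 {p. p \<in> - Q}"
    using Q(1) unfolding boldface_Pi11_def Collect_mem_eq .
  from Sigma11_comp[OF this cont] have "boldface_Sigma11 {h. (parity h, \<lambda>i. h i div 2) \<in> - Q}" .
  also have "{h. (parity h, \<lambda>i. h i div 2) \<in> - Q} = - H"
    unfolding H_def by auto
  finally have "boldface_Pi11 H"
    unfolding boldface_Pi11_def .
  moreover have "inj_on parity H"
  proof (rule inj_onI, rule ext)
    fix h k i assume "h \<in> H" "k \<in> H" "parity h = parity k"
    then have "(\<lambda>i. h i div 2) = (\<lambda>i. k i div 2)" "odd (h i) \<longleftrightarrow> odd (k i)"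
      using Q(3)[rule_format, of "parity k"] unfolding H_def by (auto simp: parity_def fun_eq_iff)
    then have "h i div 2 = k i div 2" "h i mod 2 = k i mod 2"
      by (auto simp: fun_eq_iff mod2_eq_if)
    then show "h i = k i"
      by (metis div_mult_mod_eq)
  qed
  moreover have "parity ` H = A"
  proof
    show "parity ` H \<subseteq> A"
      unfolding P(2) Q(2)[symmetric] H_def by force
    show "A \<subseteq> parity ` H"
    proof
      fix x assume "x \<in> A"
      then obtain y where y: "(x, y) \<in> Q"
        unfolding P(2) Q(2)[symmetric] by auto
      define h where "h i = 2 * y i + of_bool (x i)" for i
      have "parity h = x" "(\<lambda>i. h i div 2) = y"
        by (auto simp: h_def parity_def)
      with y show "x \<in> parity ` H"
        unfolding H_def by (intro image_eqI[of _ _ h]) simp_all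
    qed
  qed
  ultimately show ?thesis
    by (rule that)
qed

subsection \<open>Adjoining branches to an independent family\<close>

definition with_branch :: "(nat \<Rightarrow> nat) \<Rightarrow> nat set" where
  "with_branch h = {m. if even m then odd (h (m div 2))
     else map h [0..<length (list_decode (m div 2))] = list_decode (m div 2)}"

lemma code_mem_with_branch: "2 * list_encode l + 1 \<in> with_branch h \<longleftrightarrow> map h [0..<length l] = l"
  by (simp add: with_branch_def)

definition halve :: "nat set \<Rightarrow> nat set" where
  "halve z = {n. 2 * n \<in> z}"

lemma halve_with_branch: "char_fun (halve (with_branch h)) = parity h"
  by (auto simp: halve_def with_branch_def parity_def char_fun_def)

text \<open>A common initial segment cannot extend past an index \<open>i\<close> with
  \<open>h i \<noteq> k i\<close>, so its length is at most \<open>i\<close>.\<close>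

lemma finite_branches_inter:
  assumes "h \<noteq> k"
  shows "finite {m \<in> with_branch h \<inter> with_branch k. odd m}"
proof -
  obtain i where i: "h i \<noteq> k i"
    using assms by blast
  have "{m \<in> with_branch h \<inter> with_branch k. odd m}
      \<subseteq> (\<lambda>n. 2 * list_encode (map h [0..<n]) + 1) ` {..i}"
  proof
    fix m assume "m \<in> {m \<in> with_branch h \<inter> with_branch k. odd m}"
    then have m: "odd m" and hk: "map h [0..<length (list_decode (m div 2))] = list_decode (m div 2)"
        "map k [0..<length (list_decode (m div 2))] = list_decode (m div 2)"
      by (auto simp: with_branch_def)
    have "length (list_decode (m div 2)) \<le> i"
    proof (rule ccontr)
      assume "\<not> ?thesis"
      moreover have "map h [0..<length (list_decode (m div 2))] = map k [0..<length (list_decode (m div 2))]"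
        using hk by simp
      ultimately show False
        using i by auto
    qed
    moreover have "m = 2 * list_encode (map h [0..<length (list_decode (m div 2))]) + 1"
      unfolding hk(1) using m by simp
    ultimately show "m \<in> (\<lambda>n. 2 * list_encode (map h [0..<n]) + 1) ` {..i}"
      by blast
  qed
  then show ?thesis
    by (rule finite_subset) simp
qed

lemma Delta11_mem_with_branch: "Delta11 (\<lambda>p::'a::topological_space \<times> (nat \<Rightarrow> nat). m \<in> with_branch (snd p))"
proof -
  have "Delta11 (\<lambda>p::'a \<times> (nat \<Rightarrow> nat). odd (snd p i))" for i
    by (rule Delta11_rel_nat[OF continuous_on_snd_apply continuous_on_snd_apply])
  moreover have "Delta11 (\<lambda>p::'a \<times> (nat \<Rightarrow> nat). map (snd p) [0..<n] = l)" for n l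
    by (rule Delta11_map_eq[OF continuous_on_snd[OF continuous_on_id]])
  ultimately show ?thesis
    by (cases "even m") (simp_all add: with_branch_def)
qed

text \<open>A set of the form \<open>with_branch h\<close> determines \<open>h\<close> in a Borel way, so membership in the image
  of \<open>H\<close> can be expressed by a universal quantifier over candidates for \<open>h\<close>.\<close>

lemma Pi11_with_branch_image:
  assumes "boldface_Pi11 H"
  shows "boldface_Pi11 (char_fun ` with_branch ` H)"
proof -
  \<comment> \<open>Reads entry \<open>n\<close> of a real off \<open>z\<close>, as the last entry
    of a coded list of length \<open>Suc n\<close>.\<close>
  define ent where "ent z n k \<longleftrightarrow>
    (\<exists>l. (length l = Suc n \<and> l ! n = k) \<and> z (2 * list_encode l + 1))" for z :: "nat \<Rightarrow> bool" and n k
  \<comment> \<open>The second alternative covers a \<open>z\<close> with no entry at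
    \<open>n\<close>, so every \<open>z\<close> has a candidate, while a \<open>z\<close> coming
    from a branch has exactly one. Non-membership in the image thus becomes existential.\<close>
  define cand where "cand z h \<longleftrightarrow> (\<forall>n. (\<exists>k. h n = k \<and> ent z n k) \<or> (\<forall>k. \<not> ent z n k))" for z h
  have cand_unique: "h = k" if "cand (char_fun (with_branch k)) h" for h k
  proof
    fix n
    have ent: "ent (char_fun (with_branch k)) n j \<longleftrightarrow> j = k n" for j
    proof
      assume "ent (char_fun (with_branch k)) n j"
      then obtain l where l: "length l = Suc n" "l ! n = j" "map k [0..<length l] = l"
        unfolding ent_def char_fun_def code_mem_with_branch by (elim exE conjE)
      then have "map k [0..<Suc n] ! n = j"
        by simp
      then show "j = k n"
        by (simp del: upt_Suc)
    next
      assume "j = k n"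
      then show "ent (char_fun (with_branch k)) n j"
        unfolding ent_def char_fun_def code_mem_with_branch
        by (intro exI[of _ "map k [0..<Suc n]"]) (simp del: upt_Suc)
    qed
    show "h n = k n"
      using spec[OF that[unfolded cand_def], of n] ent by auto
  qed
  have cand_exists: "\<exists>h. cand z h" for z
  proof -
    have "\<forall>n. \<exists>k. ent z n k \<or> (\<forall>k. \<not> ent z n k)"
      by blast
    from choice[OF this] show ?thesis
      unfolding cand_def by auto
  qed
  have "z \<notin> char_fun ` with_branch ` H \<longleftrightarrow>
      (\<exists>h. cand z h \<and> (h \<in> - H \<or> \<not> (\<forall>m. z m \<longleftrightarrow> m \<in> with_branch h)))" for z
  proof
    assume z: "z \<notin> char_fun ` with_branch ` H"
    obtain h where "cand z h"
      using cand_exists by blast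
    moreover have "h \<in> - H \<or> \<not> (\<forall>m. z m \<longleftrightarrow> m \<in> with_branch h)"
    proof (rule ccontr)
      assume "\<not> ?thesis"
      then have "h \<in> H" "z = char_fun (with_branch h)"
        by (auto simp: char_fun_def)
      then show False
        using z by blast
    qed
    ultimately show "\<exists>h. cand z h \<and> (h \<in> - H \<or> \<not> (\<forall>m. z m \<longleftrightarrow> m \<in> with_branch h))"
      by blast
  next
    assume "\<exists>h. cand z h \<and> (h \<in> - H \<or> \<not> (\<forall>m. z m \<longleftrightarrow> m \<in> with_branch h))"
    then show "z \<notin> char_fun ` with_branch ` H"
      using cand_unique by (auto simp: char_fun_def)
  qed
  then have eq: "- char_fun ` with_branch ` H =
      {z. \<exists>h. cand z h \<and> (h \<in> - H \<or> \<not> (\<forall>m. z m \<longleftrightarrow> m \<in> with_branch h))}"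
    by blast
  have z_m: "Delta11 (\<lambda>p::(nat \<Rightarrow> bool) \<times> (nat \<Rightarrow> nat). fst p m)" for m
    using Delta11_eq[OF continuous_on_product_then_coordinatewise[OF continuous_on_fst[OF continuous_on_id]],
        of m True] by simp
  have ent: "Delta11 (\<lambda>p::(nat \<Rightarrow> bool) \<times> (nat \<Rightarrow> nat). ent (fst p) n k)" for n k
    unfolding ent_def by (intro Delta11_ex Delta11_conj Delta11_const z_m)
  have cand: "Delta11 (\<lambda>p::(nat \<Rightarrow> bool) \<times> (nat \<Rightarrow> nat). cand (fst p) (snd p))"
    unfolding cand_def
    by (intro Delta11_ex Delta11_conj Delta11_all Delta11_disj Delta11_not Delta11_eq
        continuous_on_snd_apply ent)
  have H: "boldface_Sigma11 {p::(nat \<Rightarrow> bool) \<times> (nat \<Rightarrow> nat). snd p \<in> - H}"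
    by (rule Sigma11_comp[OF _ continuous_on_snd[OF continuous_on_id]])
       (use assms in \<open>simp only: boldface_Pi11_def Collect_mem_eq\<close>)
  have neq: "Delta11 (\<lambda>p::(nat \<Rightarrow> bool) \<times> (nat \<Rightarrow> nat). \<not> (\<forall>m. fst p m \<longleftrightarrow> m \<in> with_branch (snd p)))"
    by (intro Delta11_not Delta11_all Delta11_iff z_m Delta11_mem_with_branch)
  show ?thesis
    unfolding boldface_Pi11_def eq
    by (rule Sigma11_ex_real, rule Sigma11_conj[OF Sigma11_Delta11[OF cand]
        Sigma11_disj[OF H Sigma11_Delta11[OF neq]]])
qed

section \<open>Transfer of independence and maximality\<close>

lemma independent_familyI:
  assumes "\<And>a. a \<in> \<I> \<Longrightarrow> infinite a"
    and "\<And>A B. finite A \<Longrightarrow> finite B \<Longrightarrow> A \<subseteq> \<I> \<Longrightarrow> B \<subseteq> \<I> \<Longrightarrow> A \<inter> B = {} \<Longrightarrow>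
      infinite ((\<Inter>a\<in>A. a) \<inter> (\<Inter>b\<in>B. UNIV - b))"
  shows "independent_family \<I>"
  unfolding independent_family_def using assms by simp

lemma independent_familyD:
  assumes "independent_family \<I>" "finite A" "finite B" "A \<subseteq> \<I>" "B \<subseteq> \<I>" "A \<inter> B = {}"
  shows "infinite ((\<Inter>a\<in>A. a) \<inter> (\<Inter>b\<in>B. UNIV - b))"
  using assms unfolding independent_family_def by simp

lemma inj_char_fun: "inj char_fun"
  by (rule injI) (auto simp: char_fun_def fun_eq_iff)

text \<open>Doubling a Boolean combination of halves yields even members of the original
  combination, and injectivity keeps positive and negative sets apart.\<close>

lemma independent_family_of_halve:
  assumes I: "independent_family \<I>" and inj: "inj_on halve \<J>" and sub: "halve ` \<J> \<subseteq> \<I>"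
  shows "independent_family \<J>"
proof (rule independent_familyI)
  fix a assume "a \<in> \<J>"
  then have "infinite (halve a)"
    using I sub unfolding independent_family_def by blast
  then have "infinite ((*) 2 ` halve a)"
    by (simp add: finite_image_iff inj_on_def)
  then show "infinite a"
    by (rule infinite_super[rotated]) (auto simp: halve_def)
next
  fix A B assume fin: "finite A" "finite B" and AB: "A \<subseteq> \<J>" "B \<subseteq> \<J>" "A \<inter> B = {}"
  have "halve ` A \<subseteq> \<I>" "halve ` B \<subseteq> \<I>"
    using AB sub by (meson image_mono order_trans)+
  moreover have "halve ` A \<inter> halve ` B = {}"
    using inj_on_image_Int[OF inj AB(1,2)] AB(3) by simp
  ultimately have "infinite ((\<Inter>a\<in>halve ` A. a) \<inter> (\<Inter>b\<in>halve ` B. UNIV - b))"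
    using fin by (intro independent_familyD[OF I]) simp_all
  then have "infinite ((*) 2 ` ((\<Inter>a\<in>halve ` A. a) \<inter> (\<Inter>b\<in>halve ` B. UNIV - b)))"
    by (simp add: finite_image_iff inj_on_def)
  then show "infinite ((\<Inter>a\<in>A. a) \<inter> (\<Inter>b\<in>B. UNIV - b))"
    by (rule infinite_super[rotated]) (auto simp: halve_def)
qed

text \<open>Any Boolean combination may be intersected with two further sets \<open>with_branch h\<close> and
  \<open>with_branch k\<close>. It then contains only finitely many odd numbers.\<close>

lemma infinite_halve_combination:
  assumes K: "independent_family \<K>" "with_branch ` H \<subseteq> \<K>" "infinite (with_branch ` H)"
    and AB: "finite A" "finite B" "A \<subseteq> \<K>" "B \<subseteq> \<K>" "A \<inter> B = {}"
  shows "infinite ((\<Inter>a\<in>halve ` A. a) \<inter> (\<Inter>b\<in>halve ` B. UNIV - b))" (is "infinite ?S")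
proof
  assume fin: "finite ?S"
  have inf: "infinite (with_branch ` H - B)"
    using K(3) AB(2) by simp
  \<comment> \<open>Both branch sets are taken outside \<open>B\<close>, which keeps the enlarged
    positive side disjoint from \<open>B\<close>.\<close>
  obtain x where x: "x \<in> with_branch ` H - B"
    using infinite_imp_nonempty[OF inf] by blast
  have inf': "infinite (with_branch ` H - B - {x})"
    using inf by simp
  obtain y where y: "y \<in> with_branch ` H - B - {x}"
    using infinite_imp_nonempty[OF inf'] by blast
  obtain h k where hk: "x = with_branch h" "y = with_branch k"
    using x y by auto
  define A' where "A' = insert x (insert y A)"
  have "infinite ((\<Inter>a\<in>A'. a) \<inter> (\<Inter>b\<in>B. UNIV - b))"
    unfolding A'_def using AB K(2) x y by (intro independent_familyD[OF K(1)]) auto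
  moreover have "(\<Inter>a\<in>A'. a) \<inter> (\<Inter>b\<in>B. UNIV - b) \<subseteq>
      {m \<in> with_branch h \<inter> with_branch k. odd m} \<union> (*) 2 ` ?S"
  proof
    fix m assume m: "m \<in> (\<Inter>a\<in>A'. a) \<inter> (\<Inter>b\<in>B. UNIV - b)"
    show "m \<in> {m \<in> with_branch h \<inter> with_branch k. odd m} \<union> (*) 2 ` ?S"
    proof (cases "even m")
      case True
      then obtain n where "m = 2 * n"
        by (rule evenE)
      moreover have "n \<in> ?S"
        using m unfolding A'_def halve_def \<open>m = 2 * n\<close> by (auto split: if_splits)
      ultimately show ?thesis
        by blast
    next
      case False
      then show ?thesis
        using m unfolding A'_def hk by simp
    qed
  qed
  moreover have "h \<noteq> k"
    using y hk by auto
  ultimately show False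
    using finite_branches_inter[of h k] fin by (meson finite_UnI finite_imageI finite_subset)
qed

text \<open>If some \<open>z\<close> could be added to the new family, \<open>halve z\<close> could
  be added to \<open>\<I>\<close>, because combinations from \<open>\<K>\<close> stay infinite after
  halving.\<close>

lemma maximal_independent_family_with_branch:
  assumes max: "maximal_independent_family \<I>" and inf: "infinite \<I>"
    and bij: "bij_betw halve (with_branch ` H) \<I>"
  shows "maximal_independent_family (with_branch ` H)"
proof -
  have I: "independent_family \<I>" "\<And>\<J>. independent_family \<J> \<Longrightarrow> \<I> \<subseteq> \<J> \<Longrightarrow> \<J> = \<I>"
    using max unfolding maximal_independent_family_def by auto
  have img: "halve ` with_branch ` H = \<I>"
    using bij by (rule bij_betw_imp_surj_on)
  have inf_H: "infinite (with_branch ` H)"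
    using bij_betw_finite[OF bij] inf by simp
  have "independent_family (with_branch ` H)"
    using I(1) bij_betw_imp_inj_on[OF bij] by (rule independent_family_of_halve) (simp add: img)
  moreover have "z \<in> with_branch ` H"
    if K: "independent_family \<K>" "with_branch ` H \<subseteq> \<K>" and z: "z \<in> \<K>" for \<K> z
  proof (rule ccontr)
    assume z_nin: "z \<notin> with_branch ` H"
    note key = infinite_halve_combination[OF K inf_H]
    \<comment> \<open>If \<open>halve z\<close> equalled \<open>halve r\<close> for a member
      \<open>r\<close> of the family, the halved combination of \<open>z\<close> with the complement
      of \<open>r\<close> would be empty.\<close>
    have "halve z \<notin> \<I>"
    proof
      assume "halve z \<in> \<I>"
      then obtain r where "r \<in> with_branch ` H" "halve z = halve r"
        unfolding img[symmetric] by (rule imageE)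
      with key[of "{z}" "{r}"] show False
        using z K(2) z_nin by auto
    qed
    have "independent_family (insert (halve z) \<I>)"
    proof (rule independent_familyI)
      fix a assume "a \<in> insert (halve z) \<I>"
      then show "infinite a"
        using key[of "{z}" "{}"] z I(1) unfolding independent_family_def by auto
    next
      fix A B assume AB: "finite A" "finite B" "A \<subseteq> insert (halve z) \<I>" "B \<subseteq> insert (halve z) \<I>"
        "A \<inter> B = {}"
      have ins: "insert (halve z) \<I> = halve ` insert z (with_branch ` H)"
        by (simp add: img)
      \<comment> \<open>\<open>A\<close> and \<open>B\<close> are lifted along \<open>halve\<close>
        to finite subsets of \<open>\<K>\<close>; disjoint images force disjoint lifts.\<close>
      obtain A' where A': "A' \<subseteq> insert z (with_branch ` H)" "finite A'" "A = halve ` A'"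
        using finite_subset_image[OF AB(1) AB(3)[unfolded ins]] by blast
      obtain B' where B': "B' \<subseteq> insert z (with_branch ` H)" "finite B'" "B = halve ` B'"
        using finite_subset_image[OF AB(2) AB(4)[unfolded ins]] by blast
      show "infinite ((\<Inter>a\<in>A. a) \<inter> (\<Inter>b\<in>B. UNIV - b))"
        unfolding A'(3) B'(3)
      proof (rule key[OF A'(2) B'(2)])
        have sub: "insert z (with_branch ` H) \<subseteq> \<K>"
          using z K(2) by simp
        show "A' \<subseteq> \<K>" "B' \<subseteq> \<K>"
          using order_trans[OF A'(1) sub] order_trans[OF B'(1) sub] .
        show "A' \<inter> B' = {}"
          using AB(5) unfolding A'(3) B'(3) by auto
      qed
    qed
    then have "insert (halve z) \<I> = \<I>"
      by (rule I(2)) blast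
    with \<open>halve z \<notin> \<I>\<close> show False
      by blast
  qed
  ultimately show ?thesis
    unfolding maximal_independent_family_def by (intro conjI allI impI subset_antisym subsetI) auto
qed

lemma boldface_Pi11_finite:
  fixes F :: "(nat \<Rightarrow> bool) set"
  assumes "finite F"
  shows "boldface_Pi11 F"
proof -
  have eq: "Delta11 (\<lambda>x::nat \<Rightarrow> bool. x = y)" for y
  proof -
    have "Delta11 (\<lambda>x::nat \<Rightarrow> bool. x n = y n)" for n
      by (rule Delta11_eq[OF continuous_on_product_then_coordinatewise[OF continuous_on_id]])
    then have "Delta11 (\<lambda>x::nat \<Rightarrow> bool. \<forall>n. x n = y n)"
      by (rule Delta11_all)
    then show ?thesis
      by (simp only: fun_eq_iff)
  qed
  from assms have "Delta11 (\<lambda>x. x \<in> F)"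
  proof (induction F)
    case empty
    then show ?case
      using Delta11_const[of False] by simp
  next
    case (insert y F)
    then show ?case
      using Delta11_disj[OF eq[of y]] by simp
  qed
  then show ?thesis
    by (simp add: Delta11_def boldface_Pi11_def Compl_eq)
qed

theorem theorem2p1:
  assumes "\<exists>\<I>. maximal_independent_family \<I> \<and> boldface_Sigma12 (char_fun ` \<I>)"
  shows "\<exists>\<I>. maximal_independent_family \<I> \<and> boldface_Pi11 (char_fun ` \<I>)"
proof -
  obtain \<I> where I: "maximal_independent_family \<I>" "boldface_Sigma12 (char_fun ` \<I>)"
    using assms by blast
  show ?thesis
  \<comment> \<open>A finite \<open>\<I>\<close> is itself coanalytic. The branch construction is
    applied to an infinite one, where branch sets outside any finite \<open>B\<close> exist.\<close>
  proof (cases "finite \<I>")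
    case True
    then show ?thesis
      using I(1) boldface_Pi11_finite[of "char_fun ` \<I>"] by blast
  next
    case False
    obtain H where H: "boldface_Pi11 H" "inj_on parity H" "parity ` H = char_fun ` \<I>"
      using I(2) by (rule Sigma12_injective_parity_image)
    have "char_fun ` halve ` with_branch ` H = char_fun ` \<I>"
      using H(3) by (simp add: image_image halve_with_branch)
    then have "halve ` with_branch ` H = \<I>"
      by (simp add: inj_image_eq_iff[OF inj_char_fun])
    moreover have "inj_on halve (with_branch ` H)"
    proof (rule inj_onI)
      fix x y assume "x \<in> with_branch ` H" "y \<in> with_branch ` H" "halve x = halve y"
      then obtain h k where hk: "h \<in> H" "k \<in> H" "x = with_branch h" "y = with_branch k"
          "parity h = parity k"
        using halve_with_branch by (metis imageE)
      then show "x = y"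
        using inj_onD[OF H(2) hk(5,1,2)] by simp
    qed
    ultimately have "maximal_independent_family (with_branch ` H)"
      using I(1) False by (intro maximal_independent_family_with_branch) (simp_all add: bij_betw_def)
    then show ?thesis
      using Pi11_with_branch_image[OF H(1)] by blast
  qed
qed

end
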